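(* Let $f\in K[x]=K[x_1,\ldots,x_n]$ be a homogeneous polynomial, put $f_j=\frac{\partial f}{\partial x_j}$, and assume that $f_1,\ldots,f_n$ are algebraically dependent over $K$. Let $y=(y_1,\ldots,y_n)$ be new variables, let $\phi:K[y_1,\ldots,y_n]\to K[x_1,\ldots,x_n]$ be the $K$-algebra homomorphism with $\phi(y_j)=f_j$, and let $g\in\ker\phi$ be a nonzero homogeneous polynomial of least degree in $\ker\phi$. Put $$h_j=\frac{\partial g}{\partial y_j}(f_1,\ldots,f_n)\in K[x],\qquad \boldsymbol h=(h_1,\ldots,h_n).$$ Then: (a) $f\in\mathrm{Sol}(\boldsymbol h;K[x])$. (b) $f_j\in\mathrm{Sol}(\boldsymbol h;K[x])$ for $j=1,\ldots,n$. (c) $f\in\mathrm{Sol}\left(\frac{\partial\boldsymbol h}{\partial x_j};K[x]\right)$ for $j=1,\ldots,n$, where $\frac{\partial\boldsymbol h}{\partial x_j}=\left(\frac{\partial h_1}{\partial x_j},\ldots,\frac{\partial h_n}{\partial x_j}\right)$. (d) $\boldsymbol h$ is a self-vanishing system of forms.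
   Context: $K$ is an algebraically closed field of characteristic zero. A system of forms is a nonzero vector of homogeneous polynomials in $K[x_1,\ldots,x_n]$ of the same degree. For a vector $\boldsymbol h=(h_1,\ldots,h_n)$ of polynomials in $K[x]$, set $$\mathrm{Sol}(\boldsymbol h;K[x])=\left\{F\in K[x]\ \Big|\ \sum_{j=1}^n h_j\frac{\partial F}{\partial x_j}=0\right\}.$$ A system of forms $\boldsymbol h=(h_1,\ldots,h_n)$ is self-vanishing if $h_j\in\mathrm{Sol}(\boldsymbol h;K[x])$ for all $j=1,\ldots,n$. *)

theory Defs
  imports
    "HOL-Library.Poly_Mapping"
    "HOL-Computational_Algebra.Polynomial"
begin

text \<open>
  Polynomials in finitely many variables \<open>x\<^sub>i\<close>, where \<open>i\<close> ranges over the type \<open>'n\<close>, with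
  coefficients in \<open>'a\<close>. A polynomial maps each exponent vector, itself a finitely supported map
  from the variables to the naturals, to its coefficient. The ring operations are those of
  \<^theory>\<open>HOL-Library.Poly_Mapping\<close>, i.e. convolution.
\<close>

type_synonym ('n, 'a) mpoly = "('n \<Rightarrow>\<^sub>0 nat) \<Rightarrow>\<^sub>0 'a"

definition Const :: "'a::zero \<Rightarrow> ('n, 'a) mpoly" where
  "Const c = Poly_Mapping.single 0 c"

definition Var :: "'n \<Rightarrow> ('n, 'a::zero_neq_one) mpoly" where
  "Var i = Poly_Mapping.single (Poly_Mapping.single i 1) 1"

text \<open>
  If the variable \<open>x\<^sub>i\<close> does not occur in the monomial \<open>m\<close>, the subtraction below truncates, but
  then the coefficient \<open>of_nat 0 * _\<close> vanishes.
\<close>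

definition pdiff :: "'n \<Rightarrow> ('n, 'a::comm_semiring_1) mpoly \<Rightarrow> ('n, 'a) mpoly" where
  "pdiff i p =
     (\<Sum>m\<in>Poly_Mapping.keys p.
        Poly_Mapping.single (m - Poly_Mapping.single i 1)
          (of_nat (Poly_Mapping.lookup m i) * Poly_Mapping.lookup p m))"

definition monom_degree :: "('n::finite \<Rightarrow>\<^sub>0 nat) \<Rightarrow> nat" where
  "monom_degree m = (\<Sum>i\<in>UNIV. Poly_Mapping.lookup m i)"

definition total_degree :: "('n::finite, 'a::zero) mpoly \<Rightarrow> nat" where
  "total_degree p = Max (insert 0 (monom_degree ` Poly_Mapping.keys p))"

text \<open>The zero polynomial is homogeneous of every degree.\<close>

definition homogeneous_of_degree :: "nat \<Rightarrow> ('n::finite, 'a::zero) mpoly \<Rightarrow> bool" where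
  "homogeneous_of_degree d p \<longleftrightarrow> (\<forall>m\<in>Poly_Mapping.keys p. monom_degree m = d)"

definition homogeneous :: "('n::finite, 'a::zero) mpoly \<Rightarrow> bool" where
  "homogeneous p \<longleftrightarrow> (\<exists>d. homogeneous_of_degree d p)"

text \<open>
  \<open>subst F p\<close> is \<open>p\<close> with \<open>F i\<close> substituted for the \<open>i\<close>-th variable. By the lemmas below,
  \<open>subst F\<close> is the unique homomorphism of algebras over the coefficient ring that sends the
  \<open>i\<close>-th variable to \<open>F i\<close>.
\<close>

definition subst ::
  "('n::finite \<Rightarrow> ('k, 'a::comm_semiring_1) mpoly) \<Rightarrow> ('n, 'a) mpoly \<Rightarrow> ('k, 'a) mpoly" where
  "subst F p =
     (\<Sum>m\<in>Poly_Mapping.keys p.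
        Const (Poly_Mapping.lookup p m) * (\<Prod>i\<in>UNIV. F i ^ Poly_Mapping.lookup m i))"

definition algebraically_dependent ::
  "('n::finite \<Rightarrow> ('k, 'a::comm_semiring_1) mpoly) \<Rightarrow> bool" where
  "algebraically_dependent F \<longleftrightarrow> (\<exists>p. p \<noteq> 0 \<and> subst F p = 0)"

definition Sol ::
  "('n::finite \<Rightarrow> ('n, 'a::comm_semiring_1) mpoly) \<Rightarrow> ('n, 'a) mpoly set" where
  "Sol h = {F. (\<Sum>j\<in>UNIV. h j * pdiff j F) = 0}"

definition system_of_forms :: "('n \<Rightarrow> ('n::finite, 'a::zero) mpoly) \<Rightarrow> bool" where
  "system_of_forms h \<longleftrightarrow>
     (\<exists>j. h j \<noteq> 0) \<and> (\<exists>d. \<forall>j. homogeneous_of_degree d (h j))"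

definition self_vanishing :: "('n::finite \<Rightarrow> ('n, 'a::comm_semiring_1) mpoly) \<Rightarrow> bool" where
  "self_vanishing h \<longleftrightarrow> system_of_forms h \<and> (\<forall>j. h j \<in> Sol h)"

lemma mpoly_as_sum:
  "(\<Sum>m\<in>Poly_Mapping.keys p. Poly_Mapping.single m (Poly_Mapping.lookup p m)) = p"
proof (rule poly_mapping_eqI)
  fix k
  show "Poly_Mapping.lookup (\<Sum>m\<in>Poly_Mapping.keys p.
      Poly_Mapping.single m (Poly_Mapping.lookup p m)) k = Poly_Mapping.lookup p k"
    by (auto simp: lookup_sum lookup_single when_def in_keys_iff)
qed

lemma subst_superset:
  assumes "finite A" "Poly_Mapping.keys p \<subseteq> A"
  shows "subst F p =
    (\<Sum>m\<in>A. Const (Poly_Mapping.lookup p m) * (\<Prod>i\<in>UNIV. F i ^ Poly_Mapping.lookup m i))"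
  unfolding subst_def using assms
  by (intro sum.mono_neutral_left) (auto simp: in_keys_iff Const_def)

lemma subst_zero [simp]: "subst F 0 = 0"
  by (simp add: subst_def)

lemma subst_add: "subst F (p + q) = subst F p + subst F q"
proof -
  define A where "A = Poly_Mapping.keys p \<union> Poly_Mapping.keys q"
  have A: "finite A" "Poly_Mapping.keys p \<subseteq> A" "Poly_Mapping.keys q \<subseteq> A"
    "Poly_Mapping.keys (p + q) \<subseteq> A"
    using keys_add[of p q] by (auto simp: A_def)
  show ?thesis
    by (simp add: subst_superset[OF A(1)] A lookup_add Const_def single_add
        distrib_right sum.distrib)
qed

lemma subst_sum: "subst F (sum p A) = (\<Sum>a\<in>A. subst F (p a))"
  by (induction A rule: infinite_finite_induct) (auto simp: subst_add)

lemma subst_single: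
  "subst F (Poly_Mapping.single m c) = Const c * (\<Prod>i\<in>UNIV. F i ^ Poly_Mapping.lookup m i)"
  by (subst subst_superset[of "{m}"]) (auto simp: Const_def)

lemma subst_mult:
  fixes F :: "'n::finite \<Rightarrow> ('b, 'a::comm_semiring_1) mpoly"
  shows "subst F (p * q) = subst F p * subst F q"
proof -
  have single: "subst F (Poly_Mapping.single m c * Poly_Mapping.single m' c') =
      subst F (Poly_Mapping.single m c) * subst F (Poly_Mapping.single m' c')" for m m' c c'
  proof -
    have "Const (c * c') = Const c * (Const c' :: ('b, 'a) mpoly)"
      by (simp add: Const_def mult_single)
    then show ?thesis
      by (simp add: mult_single subst_single lookup_add power_add prod.distrib ac_simps)
  qed
  have "subst F (p * q) = subst F
      ((\<Sum>m\<in>Poly_Mapping.keys p. Poly_Mapping.single m (Poly_Mapping.lookup p m)) *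
       (\<Sum>m\<in>Poly_Mapping.keys q. Poly_Mapping.single m (Poly_Mapping.lookup q m)))"
    by (simp add: mpoly_as_sum)
  also have "\<dots> = subst F
      (\<Sum>m\<in>Poly_Mapping.keys p. Poly_Mapping.single m (Poly_Mapping.lookup p m)) *
      subst F (\<Sum>m\<in>Poly_Mapping.keys q. Poly_Mapping.single m (Poly_Mapping.lookup q m))"
    by (simp add: sum_product subst_sum single)
  finally show ?thesis
    by (simp add: mpoly_as_sum)
qed

lemma subst_Const: "subst F (Const c) = Const c"
  by (simp add: Const_def subst_single)

lemma subst_Var: "subst F (Var i) = F i"
proof -
  have "(\<Prod>j\<in>UNIV. F j ^ Poly_Mapping.lookup (Poly_Mapping.single i 1) j) =
      (\<Prod>j\<in>UNIV. if j = i then F j else 1)"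
    by (intro prod.cong) (auto simp: lookup_single when_def)
  then show ?thesis
    by (simp add: Var_def subst_single Const_def prod.delta)
qed

lemma subst_unique:
  fixes \<phi> :: "('n::finite, 'a::comm_semiring_1) mpoly \<Rightarrow> ('k, 'a) mpoly"
  assumes add: "\<And>p q. \<phi> (p + q) = \<phi> p + \<phi> q"
    and mult: "\<And>p q. \<phi> (p * q) = \<phi> p * \<phi> q"
    and Const: "\<And>c. \<phi> (Const c) = Const c"
    and Var: "\<And>i. \<phi> (Var i) = F i"
  shows "\<phi> = subst F"
proof
  fix p :: "('n, 'a) mpoly"
  have zero: "\<phi> 0 = 0" and one: "\<phi> 1 = 1"
    using Const[of 0] Const[of 1] by (simp_all add: Const_def)
  have sum: "\<phi> (sum g A) = (\<Sum>a\<in>A. \<phi> (g a))" for A and g :: "('n \<Rightarrow>\<^sub>0 nat) \<Rightarrow> _"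
    by (induction A rule: infinite_finite_induct) (auto simp: add zero)
  have prod: "\<phi> (prod g A) = (\<Prod>a\<in>A. \<phi> (g a))" for A and g :: "'n \<Rightarrow> _"
    by (induction A rule: infinite_finite_induct) (auto simp: mult one)
  have power: "\<phi> (q ^ k) = \<phi> q ^ k" for q k
    by (induction k) (auto simp: mult one)
  have "subst Var p = p"
  proof -
    have pw: "Var i ^ k = Poly_Mapping.single (Poly_Mapping.single i k) (1::'a)"
      for i :: 'n and k
      by (induction k) (auto simp: Var_def mult_single simp flip: single_add)
    have pr: "(\<Prod>i\<in>A. Poly_Mapping.single (e i) (1::'a)) = Poly_Mapping.single (sum e A) 1"
      if "finite A" for A :: "'n set" and e :: "'n \<Rightarrow> 'n \<Rightarrow>\<^sub>0 nat"
      using that by induction (auto simp: mult_single)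
    have e: "(\<Sum>i\<in>UNIV. Poly_Mapping.single i (Poly_Mapping.lookup m i)) = m"
      for m :: "'n \<Rightarrow>\<^sub>0 nat"
      by (rule poly_mapping_eqI) (simp add: lookup_sum lookup_single when_def)
    show ?thesis
      by (simp add: subst_def pw pr e Const_def mult_single mpoly_as_sum)
  qed
  then have "\<phi> p = \<phi> (subst Var p)" by simp
  also have "\<dots> = subst F p"
    by (simp add: subst_def sum mult prod power Const Var)
  finally show "\<phi> p = subst F p" .
qed

end

theory Submission
  imports Defs
begin

text \<open>
  Differentiating \<open>g(f\<^sub>1, \<dots>, f\<^sub>n) = 0\<close> with respect to \<open>x\<^sub>i\<close> gives \<open>\<Sum>\<^sub>j h\<^sub>j \<partial>f\<^sub>i/\<partial>x\<^sub>j = 0\<close>, since the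
  Hessian of \<open>f\<close> is symmetric; this is (b). Euler's relation for \<open>g\<close>, evaluated at the gradient
  of \<open>f\<close>, gives (a), and differentiating (a) and subtracting (b) gives (c). By (b) the derivation
  \<open>\<Sum>\<^sub>j h\<^sub>j \<partial>/\<partial>x\<^sub>j\<close> kills every \<open>f\<^sub>i\<close>, hence every polynomial in the \<open>f\<^sub>i\<close>, in particular each \<open>h\<^sub>j\<close>.
  Finally \<open>h \<noteq> 0\<close> because a nonzero partial derivative of \<open>g\<close> in \<open>ker \<phi>\<close> would have smaller
  degree than \<open>g\<close>.
\<close>

section \<open>Formal partial derivatives: additivity, product rule, symmetry\<close>

lemma pdiff_superset:
  assumes "finite A" "Poly_Mapping.keys p \<subseteq> A"
  shows "pdiff i p =
    (\<Sum>m\<in>A. Poly_Mapping.single (m - Poly_Mapping.single i 1)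
      (of_nat (Poly_Mapping.lookup m i) * Poly_Mapping.lookup p m))"
  unfolding pdiff_def using assms
  by (intro sum.mono_neutral_left) (auto simp: in_keys_iff)

lemma pdiff_zero [simp]: "pdiff i 0 = 0"
  by (simp add: pdiff_def)

lemma pdiff_single:
  "pdiff i (Poly_Mapping.single m c) =
    Poly_Mapping.single (m - Poly_Mapping.single i 1) (of_nat (Poly_Mapping.lookup m i) * c)"
  by (subst pdiff_superset[of "{m}"]) auto

lemma pdiff_add: "pdiff i (p + q) = pdiff i p + pdiff i q"
proof -
  \<comment> \<open>Cancellation may shrink the support of \<open>p + q\<close>, so all three
    derivatives are summed over one common finite set.\<close>
  define A where "A = Poly_Mapping.keys p \<union> Poly_Mapping.keys q"
  have A: "finite A" "Poly_Mapping.keys p \<subseteq> A" "Poly_Mapping.keys q \<subseteq> A"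
    "Poly_Mapping.keys (p + q) \<subseteq> A"
    using keys_add[of p q] by (auto simp: A_def)
  show ?thesis
    by (simp add: pdiff_superset[OF A(1)] A lookup_add single_add distrib_left sum.distrib)
qed

lemma pdiff_sum: "pdiff i (sum p A) = (\<Sum>a\<in>A. pdiff i (p a))"
  by (induction A rule: infinite_finite_induct) (auto simp: pdiff_add)

lemma pdiff_mult:
  fixes p q :: "('n, 'a::comm_semiring_1) mpoly"
  shows "pdiff i (p * q) = pdiff i p * q + p * pdiff i q"
proof -
  let ?e = "Poly_Mapping.single i (1::nat)"
  \<comment> \<open>Truncated subtraction commutes with adding \<open>m'\<close> once variable
    \<open>i\<close> occurs in \<open>m\<close>. If it does not, the coefficients in
    \<open>left\<close> are zero and the exponents do not matter.\<close>
  have minus: "m - ?e + m' = m + m' - ?e" if "Poly_Mapping.lookup m i \<noteq> 0"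
    for m m' :: "'n \<Rightarrow>\<^sub>0 nat"
    using that by (intro poly_mapping_eqI) (auto simp: lookup_add lookup_minus lookup_single when_def)
  have left: "Poly_Mapping.single (m - ?e) (of_nat (Poly_Mapping.lookup m i) * c) *
        Poly_Mapping.single m' c' =
      Poly_Mapping.single (m + m' - ?e) (of_nat (Poly_Mapping.lookup m i) * c * c')"
    for m m' :: "'n \<Rightarrow>\<^sub>0 nat" and c c' :: 'a
    using minus[of m m'] by (cases "Poly_Mapping.lookup m i = 0") (simp_all add: mult_single)
  have right: "Poly_Mapping.single m c *
        Poly_Mapping.single (m' - ?e) (of_nat (Poly_Mapping.lookup m' i) * c') =
      Poly_Mapping.single (m + m' - ?e) (of_nat (Poly_Mapping.lookup m' i) * c * c')"
    for m m' :: "'n \<Rightarrow>\<^sub>0 nat" and c c' :: 'a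
    using left[of m' c' m c] by (simp add: ac_simps)
  have single: "pdiff i (Poly_Mapping.single m c * Poly_Mapping.single m' c') =
      pdiff i (Poly_Mapping.single m c) * Poly_Mapping.single m' c' +
      Poly_Mapping.single m c * pdiff i (Poly_Mapping.single m' c')"
    for m m' :: "'n \<Rightarrow>\<^sub>0 nat" and c c' :: 'a
    unfolding pdiff_single left right
    by (simp add: mult_single pdiff_single lookup_add distrib_right mult.assoc flip: single_add)
  have "pdiff i (P * Q) = pdiff i P * Q + P * pdiff i Q"
    if "P = (\<Sum>m\<in>Poly_Mapping.keys p. Poly_Mapping.single m (Poly_Mapping.lookup p m))"
      "Q = (\<Sum>m\<in>Poly_Mapping.keys q. Poly_Mapping.single m (Poly_Mapping.lookup q m))" for P Q
    unfolding that by (simp add: sum_product pdiff_sum single sum.distrib)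
  from this[OF refl refl] show ?thesis
    by (simp add: mpoly_as_sum)
qed

lemma pdiff_Const [simp]: "pdiff i (Const c) = 0"
  by (simp add: Const_def pdiff_single)

lemma pdiff_Var: "pdiff i (Var j) = (if i = j then 1 else 0)"
  by (simp add: Var_def pdiff_single lookup_single when_def)

text \<open>By additivity monomials suffice. For distinct variables both orders produce the product
  of the two exponents as a factor, and truncated subtractions may be done in either order.\<close>

lemma pdiff_commute:
  fixes p :: "('n, 'a::comm_semiring_1) mpoly"
  shows "pdiff i (pdiff j p) = pdiff j (pdiff i p)"
proof -
  have single: "pdiff i (pdiff j (Poly_Mapping.single m c)) =
      pdiff j (pdiff i (Poly_Mapping.single m c))" for m :: "'n \<Rightarrow>\<^sub>0 nat" and c :: 'a
    by (simp add: pdiff_single lookup_minus lookup_single when_def ac_simps diff_diff_add)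
  have "pdiff i (pdiff j P) = pdiff j (pdiff i P)"
    if "P = (\<Sum>m\<in>Poly_Mapping.keys p. Poly_Mapping.single m (Poly_Mapping.lookup p m))" for P
    unfolding that by (simp add: pdiff_sum single)
  from this[OF refl] show ?thesis
    by (simp add: mpoly_as_sum)
qed

section \<open>Induction on polynomials and the chain rule\<close>

lemma subst_Var_id: "subst Var p = p"
proof -
  have "(\<lambda>p. p) = subst Var"
    by (rule subst_unique) simp_all
  then show ?thesis by metis
qed

text \<open>Constants and variables generate the polynomial ring: \<open>subst Var p\<close> is
  equal to \<open>p\<close> and is, by definition, built from them by sums and products.\<close>

lemma mpoly_induct [case_names Const Var add mult]:
  fixes p :: "('n::finite, 'a::comm_semiring_1) mpoly"
  assumes Const: "\<And>c. P (Const c)"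
    and Var: "\<And>i. P (Var i)"
    and add: "\<And>p q. P p \<Longrightarrow> P q \<Longrightarrow> P (p + q)"
    and mult: "\<And>p q. P p \<Longrightarrow> P q \<Longrightarrow> P (p * q)"
  shows "P p"
proof -
  have zero: "P 0" and one: "P 1"
    using Const[of 0] Const[of 1] by (simp_all add: Const_def)
  have sum: "P (sum g A)" if "\<And>a. P (g a)" for A and g :: "('n \<Rightarrow>\<^sub>0 nat) \<Rightarrow> _"
    using that by (induction A rule: infinite_finite_induct) (auto simp: add zero)
  have prod: "P (prod g A)" if "\<And>a. P (g a)" for A and g :: "'n \<Rightarrow> _"
    using that by (induction A rule: infinite_finite_induct) (auto simp: mult one)
  have power: "P (q ^ k)" if "P q" for q k
    using that by (induction k) (auto simp: mult one)
  have "P (subst Var p)"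
    unfolding subst_def by (intro sum mult prod power Const Var)
  then show ?thesis
    by (simp add: subst_Var_id)
qed

text \<open>The chain rule. Both sides are additive in \<open>p\<close> and obey the product rule
  along \<open>subst F\<close>, so agreement on constants and variables is enough.\<close>

lemma pdiff_subst:
  fixes F :: "'n::finite \<Rightarrow> ('k, 'a::comm_semiring_1) mpoly"
  shows "pdiff k (subst F p) = (\<Sum>i\<in>UNIV. subst F (pdiff i p) * pdiff k (F i))"
proof (induction p rule: mpoly_induct)
  case (Const c)
  then show ?case by (simp add: subst_Const)
next
  case (Var i)
  have "subst F 1 = 1"
    using subst_Const[of F 1] by (simp add: Const_def)
  then have "(\<Sum>j\<in>UNIV. subst F (pdiff j (Var i)) * pdiff k (F j)) =
      (\<Sum>j\<in>UNIV. if j = i then pdiff k (F j) else 0)"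
    by (intro sum.cong) (auto simp: pdiff_Var)
  then show ?case by (simp add: subst_Var)
next
  case (add p q)
  then show ?case by (simp add: subst_add pdiff_add distrib_right sum.distrib)
next
  case (mult p q)
  then show ?case
    by (simp add: subst_add subst_mult pdiff_mult sum.distrib sum_distrib_left sum_distrib_right
        algebra_simps)
qed

section \<open>Degrees, homogeneity and Euler's relation\<close>

lemma monom_degree_add: "monom_degree (m + m') = monom_degree m + monom_degree m'"
  by (simp add: monom_degree_def lookup_add sum.distrib)

lemma monom_degree_single: "monom_degree (Poly_Mapping.single i k) = k"
  by (simp add: monom_degree_def lookup_single when_def)

lemma monom_degree_diff_single:
  assumes "Poly_Mapping.lookup m i \<noteq> 0"
  shows "monom_degree (m - Poly_Mapping.single i 1) = monom_degree m - 1"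
proof -
  have "m = m - Poly_Mapping.single i 1 + Poly_Mapping.single i 1"
    using assms
    by (intro poly_mapping_eqI) (auto simp: lookup_add lookup_minus lookup_single when_def)
  then have "monom_degree m = monom_degree (m - Poly_Mapping.single i 1) + 1"
    by (metis monom_degree_add monom_degree_single)
  then show ?thesis by simp
qed

lemma homogeneous_of_degree_zero [simp]: "homogeneous_of_degree d 0"
  by (simp add: homogeneous_of_degree_def)

lemma homogeneous_of_degree_Const: "homogeneous_of_degree 0 (Const c)"
  by (simp add: homogeneous_of_degree_def Const_def monom_degree_def)

lemma homogeneous_of_degree_add:
  assumes "homogeneous_of_degree d p" "homogeneous_of_degree d q"
  shows "homogeneous_of_degree d (p + q)"
  using assms keys_add[of p q] by (auto simp: homogeneous_of_degree_def)

lemma homogeneous_of_degree_sum: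
  assumes "\<And>a. a \<in> A \<Longrightarrow> homogeneous_of_degree d (p a)"
  shows "homogeneous_of_degree d (sum p A)"
  using assms
  by (induction A rule: infinite_finite_induct) (auto intro: homogeneous_of_degree_add)

lemma homogeneous_of_degree_mult:
  assumes "homogeneous_of_degree d p" "homogeneous_of_degree e q"
  shows "homogeneous_of_degree (d + e) (p * q)"
  unfolding homogeneous_of_degree_def
proof
  fix m assume "m \<in> Poly_Mapping.keys (p * q)"
  then obtain a b where "m = a + b" "a \<in> Poly_Mapping.keys p" "b \<in> Poly_Mapping.keys q"
    using keys_mult[of p q] by blast
  then show "monom_degree m = d + e"
    using assms by (simp add: homogeneous_of_degree_def monom_degree_add)
qed

lemma homogeneous_of_degree_power:
  fixes p :: "('n::finite, 'a::comm_semiring_1) mpoly"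
  assumes "homogeneous_of_degree d p"
  shows "homogeneous_of_degree (k * d) (p ^ k)"
  using assms homogeneous_of_degree_Const[of "1::'a"]
  by (induction k) (auto intro: homogeneous_of_degree_mult simp: Const_def)

lemma homogeneous_of_degree_prod:
  fixes p :: "'b \<Rightarrow> ('n::finite, 'a::comm_semiring_1) mpoly"
  assumes "\<And>a. a \<in> A \<Longrightarrow> homogeneous_of_degree (d a) (p a)"
  shows "homogeneous_of_degree (sum d A) (prod p A)"
  using assms homogeneous_of_degree_Const[of "1::'a"]
  by (induction A rule: infinite_finite_induct)
    (auto intro: homogeneous_of_degree_mult simp: Const_def)

text \<open>Terms without variable \<open>i\<close> contribute zero, which is homogeneous of every
  degree. This covers \<open>d = 0\<close>, where \<open>d - 1\<close> truncates to
  \<open>0\<close>.\<close>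

lemma homogeneous_of_degree_pdiff:
  assumes "homogeneous_of_degree d p"
  shows "homogeneous_of_degree (d - 1) (pdiff i p)"
  unfolding pdiff_def
proof (rule homogeneous_of_degree_sum)
  fix m assume "m \<in> Poly_Mapping.keys p"
  then have "monom_degree m = d"
    using assms by (simp add: homogeneous_of_degree_def)
  then show "homogeneous_of_degree (d - 1) (Poly_Mapping.single (m - Poly_Mapping.single i 1)
      (of_nat (Poly_Mapping.lookup m i) * Poly_Mapping.lookup p m))"
    using monom_degree_diff_single[of m i]
    by (cases "Poly_Mapping.lookup m i = 0") (auto simp: homogeneous_of_degree_def)
qed

lemma homogeneous_of_degree_subst:
  fixes F :: "'n::finite \<Rightarrow> ('k::finite, 'a::comm_semiring_1) mpoly"
  assumes "homogeneous_of_degree r p" "\<And>i. homogeneous_of_degree s (F i)"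
  shows "homogeneous_of_degree (r * s) (subst F p)"
  unfolding subst_def
proof (rule homogeneous_of_degree_sum)
  fix m assume "m \<in> Poly_Mapping.keys p"
  \<comment> \<open>The degree is split to match the factors of a term: \<open>0\<close> from the
    coefficient and exponent times \<open>s\<close> from each power.\<close>
  then have "r * s = 0 + (\<Sum>i\<in>UNIV. Poly_Mapping.lookup m i * s)"
    using assms(1) by (auto simp: homogeneous_of_degree_def monom_degree_def sum_distrib_right)
  then show "homogeneous_of_degree (r * s)
      (Const (Poly_Mapping.lookup p m) * (\<Prod>i\<in>UNIV. F i ^ Poly_Mapping.lookup m i))"
    using assms(2)
    by (simp only:) (intro homogeneous_of_degree_mult homogeneous_of_degree_Const
        homogeneous_of_degree_prod homogeneous_of_degree_power)
qed

text \<open>Links the \<open>total_degree\<close> that \<open>g\<close> minimises to the degree of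
  homogeneity. As \<open>p\<close> is nonzero, its set of monomial degrees is exactly
  \<open>{d}\<close>.\<close>

lemma total_degree_homogeneous:
  assumes "homogeneous_of_degree d p" "p \<noteq> 0"
  shows "total_degree p = d"
proof -
  have "monom_degree ` Poly_Mapping.keys p = {d}"
    using assms unfolding homogeneous_of_degree_def
    by (metis image_cong image_constant_conv keys_eq_empty)
  then show ?thesis by (simp add: total_degree_def)
qed

text \<open>The operator \<open>Var i * pdiff i\<close> multiplies each monomial by its exponent of
  variable \<open>i\<close>; summing over \<open>i\<close> multiplies it by its degree.\<close>

lemma euler_homogeneous:
  fixes p :: "('n::finite, 'a::comm_semiring_1) mpoly"
  assumes "homogeneous_of_degree d p"
  shows "(\<Sum>i\<in>UNIV. Var i * pdiff i p) = Const (of_nat d) * p"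
proof -
  have Var_mult: "Var i * Poly_Mapping.single (m - Poly_Mapping.single i 1)
        (of_nat (Poly_Mapping.lookup m i) * c) =
      Poly_Mapping.single m (of_nat (Poly_Mapping.lookup m i) * c)"
    for i and m :: "'n \<Rightarrow>\<^sub>0 nat" and c :: 'a
  proof (cases "Poly_Mapping.lookup m i = 0")
    case False
    then have "Poly_Mapping.single i 1 + (m - Poly_Mapping.single i 1) = m"
      by (intro poly_mapping_eqI) (auto simp: lookup_add lookup_minus lookup_single when_def)
    then show ?thesis by (simp add: Var_def mult_single)
  qed simp
  have single_sum: "(\<Sum>i\<in>A. Poly_Mapping.single m (c i)) = Poly_Mapping.single m (sum c A)"
    for A :: "'n set" and m :: "'n \<Rightarrow>\<^sub>0 nat" and c :: "'n \<Rightarrow> 'a"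
    by (induction A rule: infinite_finite_induct) (auto simp: single_add)
  have "(\<Sum>i\<in>UNIV. Var i * pdiff i p) = (\<Sum>i\<in>UNIV. \<Sum>m\<in>Poly_Mapping.keys p.
      Poly_Mapping.single m (of_nat (Poly_Mapping.lookup m i) * Poly_Mapping.lookup p m))"
    by (simp only: pdiff_def sum_distrib_left Var_mult)
  also have "\<dots> = (\<Sum>m\<in>Poly_Mapping.keys p.
      Poly_Mapping.single m (of_nat (monom_degree m) * Poly_Mapping.lookup p m))"
    by (subst sum.swap) (simp add: single_sum monom_degree_def sum_distrib_right)
  also have "\<dots> = (\<Sum>m\<in>Poly_Mapping.keys p.
      Const (of_nat d) * Poly_Mapping.single m (Poly_Mapping.lookup p m))"
    using assms
    by (intro sum.cong) (auto simp: homogeneous_of_degree_def Const_def mult_single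
        simp del: single_of_nat)
  also have "\<dots> = Const (of_nat d) * p"
    by (simp only: mpoly_as_sum flip: sum_distrib_left)
  finally show ?thesis .
qed

lemma homogeneous_of_degree_0_imp_Const:
  assumes "homogeneous_of_degree 0 p"
  shows "p = Const (Poly_Mapping.lookup p 0)"
proof (rule poly_mapping_eqI)
  fix m
  have "m = 0" if "m \<in> Poly_Mapping.keys p"
    using assms that
    by (intro poly_mapping_eqI) (auto simp: homogeneous_of_degree_def monom_degree_def)
  then show "Poly_Mapping.lookup p m = Poly_Mapping.lookup (Const (Poly_Mapping.lookup p 0)) m"
    by (auto simp: Const_def lookup_single when_def in_keys_iff)
qed

text \<open>By the chain rule, the derivation given by \<open>h\<close> maps
  \<open>subst F p\<close> to a linear combination of its values on the \<open>F i\<close>, which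
  are all zero.\<close>

lemma subst_in_Sol:
  fixes h :: "'n::finite \<Rightarrow> ('n, 'a::comm_semiring_1) mpoly"
    and F :: "'m::finite \<Rightarrow> ('n, 'a) mpoly"
  assumes "\<And>i. F i \<in> Sol h"
  shows "subst F p \<in> Sol h"
proof -
  have "(\<Sum>k\<in>UNIV. h k * pdiff k (subst F p)) =
      (\<Sum>k\<in>UNIV. \<Sum>i\<in>UNIV. subst F (pdiff i p) * (h k * pdiff k (F i)))"
    by (simp add: pdiff_subst sum_distrib_left ac_simps)
  also have "\<dots> = (\<Sum>i\<in>UNIV. subst F (pdiff i p) * (\<Sum>k\<in>UNIV. h k * pdiff k (F i)))"
    by (subst sum.swap) (simp add: sum_distrib_left)
  finally show ?thesis
    using assms by (simp add: Sol_def)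
qed

theorem theorem3p9:
  fixes f g :: "('n::finite, 'a::{alg_closed_field, field_char_0}) mpoly"
    and \<phi> :: "('n, 'a) mpoly \<Rightarrow> ('n, 'a) mpoly"
    and h :: "'n \<Rightarrow> ('n, 'a) mpoly"
  assumes "homogeneous f"
    and "algebraically_dependent (\<lambda>j. pdiff j f)"
    and "\<phi> = subst (\<lambda>j. pdiff j f)"
    and "is_arg_min total_degree (\<lambda>p. p \<in> \<phi> -` {0} \<and> p \<noteq> 0 \<and> homogeneous p) g"
    and "h = (\<lambda>j. subst (\<lambda>i. pdiff i f) (pdiff j g))"
  shows "f \<in> Sol h \<and>
    (\<forall>j. pdiff j f \<in> Sol h) \<and>
    (\<forall>j. f \<in> Sol (\<lambda>i. pdiff j (h i))) \<and>
    self_vanishing h"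
proof -
  let ?F = "\<lambda>j. pdiff j f"
  have h: "h j = subst ?F (pdiff j g)" for j
    using assms(5) by simp
  have g: "subst ?F g = 0" "g \<noteq> 0" "homogeneous g"
    using assms(3,4) by (auto simp: is_arg_min_def)
  have g_min: "total_degree g \<le> total_degree p"
    if "subst ?F p = 0" "p \<noteq> 0" "homogeneous p" for p
    using assms(3,4) that by (auto simp: is_arg_min_def not_less)
  obtain r where r: "homogeneous_of_degree r g"
    using g(3) by (auto simp: homogeneous_def)
  obtain d where d: "homogeneous_of_degree d f"
    using assms(1) by (auto simp: homogeneous_def)
  have euler: "(\<Sum>i\<in>UNIV. Var i * pdiff i g) = Const (of_nat r) * g"
    using r by (rule euler_homogeneous)
  \<comment> \<open>Substitution fixes constants, so a nonzero constant cannot lie in the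
    kernel.\<close>
  have "r \<noteq> 0"
  proof
    assume "r = 0"
    then have "g = Const (Poly_Mapping.lookup g 0)"
      using r homogeneous_of_degree_0_imp_Const by blast
    then show False
      using g(1,2) by (metis subst_Const)
  qed

  \<comment> \<open>Since \<open>subst ?F\<close> sends \<open>Var i\<close> to
    \<open>pdiff i f\<close>, the sum in (a) is the image of Euler's sum for \<open>g\<close>, a
    multiple of \<open>g\<close>.\<close>
  have "(\<Sum>j\<in>UNIV. h j * pdiff j f) = subst ?F (\<Sum>i\<in>UNIV. Var i * pdiff i g)"
    by (simp add: subst_sum subst_mult subst_Var h mult.commute)
  then have a: "(\<Sum>j\<in>UNIV. h j * pdiff j f) = 0"
    by (simp add: euler subst_mult g(1))

  have b: "(\<Sum>j\<in>UNIV. h j * pdiff j (pdiff i f)) = 0" for i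
    using pdiff_subst[of i ?F g] by (simp add: g(1) h pdiff_commute[of i])

  have c: "(\<Sum>i\<in>UNIV. pdiff j (h i) * pdiff i f) = 0" for j
  proof -
    have "0 = pdiff j (\<Sum>i\<in>UNIV. h i * pdiff i f)"
      by (simp add: a)
    \<comment> \<open>The other half of the product rule is the sum in \<open>b\<close>, after
      exchanging the order of differentiation.\<close>
    also have "\<dots> = (\<Sum>i\<in>UNIV. pdiff j (h i) * pdiff i f)"
      using b[of j] by (simp add: pdiff_sum pdiff_mult sum.distrib pdiff_commute[of j])
    finally show ?thesis by simp
  qed

  have "\<exists>j. h j \<noteq> 0"
  proof (rule ccontr)
    assume "\<not> (\<exists>j. h j \<noteq> 0)"
    then have vanish: "subst ?F (pdiff j g) = 0" for j
      by (simp add: h)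
    have hom: "homogeneous_of_degree (r - 1) (pdiff j g)" for j
      using r by (rule homogeneous_of_degree_pdiff)
    have "pdiff j g = 0" for j
    proof (rule ccontr)
      assume "pdiff j g \<noteq> 0"
      \<comment> \<open>This derivative would be a nonzero form of degree \<open>r - 1\<close> in
        the kernel, against the minimality of \<open>g\<close>.\<close>
      then have "r \<le> r - 1"
        using g_min[OF vanish[of j]] hom[of j] r g(2) total_degree_homogeneous
        unfolding homogeneous_def by metis
      then show False
        using \<open>r \<noteq> 0\<close> by simp
    qed
    \<comment> \<open>Characteristic zero enters here: \<open>r\<close> is nonzero, hence invertible
      in the field, so Euler's relation forces \<open>g = 0\<close>.\<close>
    then have "Const (of_nat r) * g = 0"
      using euler by simp
    then have "Const (inverse (of_nat r)) * Const (of_nat r) * g = 0"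
      by (simp add: mult.assoc)
    moreover have "Const (inverse (of_nat r :: 'a)) * Const (of_nat r) = (1 :: ('n, 'a) mpoly)"
      using \<open>r \<noteq> 0\<close> by (simp add: Const_def mult_single del: single_of_nat)
    ultimately show False
      using g(2) by simp
  qed
  \<comment> \<open>A form of degree \<open>r - 1\<close> is evaluated at forms of degree
    \<open>d - 1\<close>, so the degree is the same for all \<open>j\<close>.\<close>
  moreover have "homogeneous_of_degree ((r - 1) * (d - 1)) (h j)" for j
    unfolding h using r d by (intro homogeneous_of_degree_subst homogeneous_of_degree_pdiff)
  ultimately have "system_of_forms h"
    by (auto simp: system_of_forms_def)
  \<comment> \<open>Each \<open>h j\<close> is a polynomial in the \<open>pdiff i f\<close>, which
    lie in \<open>Sol h\<close> by \<open>b\<close>.\<close>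
  moreover have "h j \<in> Sol h" for j
    unfolding h[of j] by (rule subst_in_Sol) (simp add: Sol_def b)
  ultimately show ?thesis
    using a b c by (simp add: Sol_def self_vanishing_def)
qed

end
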